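(* Let $\rho\in\mathbb R^m$ be a vector with positive entries, let $r:\{a\in\mathbb R^m: a\le\rho\}\to\mathbb R$ be a regularizer satisfying the regularizer assumptions given in the context (in particular $r$ is concave and $L$-Lipschitz in $\|\cdot\|_\infty$), and let $\mathcal D=\{\mu\in\mathbb R^m : r^*(-\mu)<+\infty\}$. Then the following hold: (i) The set $\mathcal D$ is convex, and the positive orthant is inside the recession cone of $\mathcal D$, i.e. $\mathbb R^m_+\subseteq \mathrm{recc}(\mathcal D)$. (ii) $Le\in\mathcal D$, where $e$ is the all-one vector in $\mathbb R^m$. (iii) Let $a\in\arg\max_{a'\le\rho}\{r(a')+\mu^\top a'\}$, where $\mu\in\mathbb R^m$. If $\mu_j\ge L$, then $a_j=\rho_j$. (iv) For any $\mu\in\mathcal D$, we have $\sum_{j=1}^m(\mu_j)^-\le L$, where $(\mu_j)^-=\max\{-\mu_j,0\}$ is the negative part of $\mu_j$.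
   Context: Vector inequalities are coordinate-wise. The conjugate of $r$ is $r^*(-\mu)=\sup_{a\le\rho}\{r(a)+\mu^\top a\}$ for $\mu\in\mathbb R^m$ (the supremum is over all $a\in\mathbb R^m$ with $a\le\rho$; entries of $a$ may be negative). The recession cone of a convex set $C$ is $\mathrm{recc}(C)=\{v: x+\lambda v\in C\ \text{for all } x\in C,\ \lambda\ge 0\}$. Regularizer assumptions: (1) $|r(a_1)-r(a_2)|\le L\|a_1-a_2\|_\infty$ for all $a_1,a_2\le\rho$; (2) there is a constant $\bar a$ such that for any $\mu\in\mathcal D$ there exists $a\in\arg\max_{a\le\rho}\{r(a)+\mu^\top a\}$ with $\|a\|_\infty\le\bar a$; (3) there exists $\bar r$ such that $0\le r(a)\le\bar r$ for all $0\le a\le\rho$; (4) $r$ is concave.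
   Formalization: Part (iii) fails when μ_j = L (m=1, ρ=1, r(a)=1−a, μ=L=1: every a ≤ 1 is a maximizer). Proved instead: a_j = ρ_j for every maximizer if μ_j > L; and replacing a_j by ρ_j at all j with μ_j ≥ L again gives a maximizer. *)

theory Defs
  imports "HOL-Analysis.Analysis"
begin

text \<open>
  A regularizer is a function on the set of all \<open>a \<le> \<rho>\<close> (coordinate-wise order).  It is represented
  by a total function \<open>r\<close>, and every notion below only looks at its values on \<open>{..\<rho>}\<close>.
\<close>

text \<open>
  The sign in the objective makes \<open>conjugate \<rho> r (- \<mu>)\<close> the supremum of \<open>r a + \<mu> \<bullet> a\<close>; the
  supremum is taken in the extended reals, so that it may be infinite.
\<close>

definition conjugate :: "real ^ 'm \<Rightarrow> (real ^ 'm \<Rightarrow> real) \<Rightarrow> real ^ 'm \<Rightarrow> ereal"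
  where "conjugate \<rho> r \<nu> = (SUP a\<in>{..\<rho>}. ereal (r a - \<nu> \<bullet> a))"

definition dual_domain :: "real ^ 'm \<Rightarrow> (real ^ 'm \<Rightarrow> real) \<Rightarrow> (real ^ 'm) set"
  where "dual_domain \<rho> r = {\<mu>. conjugate \<rho> r (- \<mu>) < \<infinity>}"

text \<open>
  Pitfall: when \<open>\<mu> $ j = L\<close> for a Lipschitz constant \<open>L\<close> of \<open>r\<close>, not every maximizer \<open>a\<close> satisfies
  \<open>a $ j = \<rho> $ j\<close>.  In dimension one, with \<open>\<rho> = 1\<close>, \<open>r a = 1 - a\<close> and \<open>\<mu> = L = 1\<close>, the objective is
  constant and every \<open>a \<le> 1\<close> is a maximizer.
\<close>

definition maximizers ::
    "real ^ 'm \<Rightarrow> (real ^ 'm \<Rightarrow> real) \<Rightarrow> real ^ 'm \<Rightarrow> (real ^ 'm) set"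
  where "maximizers \<rho> r \<mu> = {a. is_arg_max (\<lambda>a'. r a' + \<mu> \<bullet> a') (\<lambda>a'. a' \<le> \<rho>) a}"

definition recession_cone :: "'a::real_vector set \<Rightarrow> 'a set"
  where "recession_cone C = {v. \<forall>x\<in>C. \<forall>t\<ge>0. x + t *\<^sub>R v \<in> C}"

text \<open>
  On \<^typ>\<open>real ^ 'm\<close> the library's \<^const>\<open>infnorm\<close> is the maximum norm.
\<close>

definition regularizer_assumptions ::
    "real ^ 'm \<Rightarrow> (real ^ 'm \<Rightarrow> real) \<Rightarrow> real \<Rightarrow> bool"
  where "regularizer_assumptions \<rho> r L \<longleftrightarrow>
    (\<forall>a\<^sub>1\<le>\<rho>. \<forall>a\<^sub>2\<le>\<rho>. \<bar>r a\<^sub>1 - r a\<^sub>2\<bar> \<le> L * infnorm (a\<^sub>1 - a\<^sub>2)) \<and>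
    (\<exists>abar. \<forall>\<mu>\<in>dual_domain \<rho> r. \<exists>a\<in>maximizers \<rho> r \<mu>. infnorm a \<le> abar) \<and>
    (\<exists>rbar. \<forall>a. 0 \<le> a \<and> a \<le> \<rho> \<longrightarrow> 0 \<le> r a \<and> r a \<le> rbar) \<and>
    concave_on {..\<rho>} r"

end

theory Submission
  imports Defs
begin

text \<open>
  Part (i) holds because \<open>a \<le> \<rho>\<close> bounds \<open>v \<bullet> a\<close> by \<open>v \<bullet> \<rho>\<close> for every \<open>v \<ge> 0\<close>.  For (ii) and (iii),
  moving from \<open>a\<close> up to \<open>b\<close> costs at most \<open>L * infnorm (b - a)\<close> in \<open>r\<close>, which is at most \<open>L\<close> times the
  sum of the coordinates of \<open>b - a\<close> and is therefore paid for by the linear term as soon as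
  \<open>\<mu> $ j \<ge> L\<close> on the coordinates that move.
  For (iv), moving away from \<open>\<rho>\<close> at unit speed in exactly the coordinates with \<open>\<mu> $ j < 0\<close> changes the
  objective at a rate of at least \<open>(\<Sum>j. (\<mu> $ j)\<^sup>-) - L\<close>, so a finite supremum forces this rate to be
  nonpositive.
\<close>

lemma infnorm_le_cart:
  fixes x :: "real ^ 'n"
  assumes "\<And>i. \<bar>x $ i\<bar> \<le> b"
  shows "infnorm x \<le> b"
  unfolding infnorm_cart using assms by (intro cSup_least) auto

text \<open>Trades the maximum norm for a sum, so that Lipschitz estimates can be compared with the
  linear term coordinate by coordinate.\<close>

lemma infnorm_le_sum_cart:
  fixes x :: "real ^ 'n"
  assumes "0 \<le> x"
  shows "infnorm x \<le> (\<Sum>i\<in>UNIV. x $ i)"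
proof -
  have "infnorm x \<le> (\<Sum>i\<in>UNIV. \<bar>x $ i\<bar>)"
    using infnorm_le_norm norm_le_l1_cart order_trans by blast
  then show ?thesis
    using assms by (simp add: less_eq_vec_def)
qed

text \<open>Replaces finiteness of an extended-real supremum by a real upper bound, which keeps the
  later arguments inside the reals.\<close>

lemma dual_domain_iff:
  "\<mu> \<in> dual_domain \<rho> r \<longleftrightarrow> (\<exists>B. \<forall>a\<le>\<rho>. r a + \<mu> \<bullet> a \<le> B)"
proof
  assume "\<mu> \<in> dual_domain \<rho> r"
  then have "(SUP a\<in>{..\<rho>}. ereal (r a + \<mu> \<bullet> a)) < \<infinity>"
    by (simp add: dual_domain_def conjugate_def)
  then obtain B where "(SUP a\<in>{..\<rho>}. ereal (r a + \<mu> \<bullet> a)) < ereal B"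
    using less_PInf_Ex_of_nat by auto
  then have "\<forall>a\<le>\<rho>. r a + \<mu> \<bullet> a \<le> B"
    by (metis SUP_lessD atMost_iff less_ereal.simps(1) less_imp_le)
  then show "\<exists>B. \<forall>a\<le>\<rho>. r a + \<mu> \<bullet> a \<le> B" ..
next
  assume "\<exists>B. \<forall>a\<le>\<rho>. r a + \<mu> \<bullet> a \<le> B"
  then obtain B where "\<forall>a\<le>\<rho>. r a + \<mu> \<bullet> a \<le> B" ..
  then have "(SUP a\<in>{..\<rho>}. ereal (r a + \<mu> \<bullet> a)) \<le> ereal B"
    by (intro SUP_least) simp
  then show "\<mu> \<in> dual_domain \<rho> r"
    using less_ereal.simps(4) order_le_less_trans
    by (fastforce simp: dual_domain_def conjugate_def)
qed

lemma convex_dual_domain: "convex (dual_domain \<rho> r)"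
proof (rule convexI)
  fix x y and u v :: real
  assume "x \<in> dual_domain \<rho> r" "y \<in> dual_domain \<rho> r" and uv: "0 \<le> u" "0 \<le> v" "u + v = 1"
  then obtain B C where B: "\<forall>a\<le>\<rho>. r a + x \<bullet> a \<le> B" and C: "\<forall>a\<le>\<rho>. r a + y \<bullet> a \<le> C"
    by (auto simp: dual_domain_iff)
  have "r a + (u *\<^sub>R x + v *\<^sub>R y) \<bullet> a \<le> u * B + v * C" if "a \<le> \<rho>" for a
  proof -
    \<comment> \<open>The objective is affine in \<mu>; writing \<open>r a\<close> with the factor
      \<open>u + v = 1\<close> distributes it over the two bounds.\<close>
    have "r a + (u *\<^sub>R x + v *\<^sub>R y) \<bullet> a = (u + v) * r a + u * (x \<bullet> a) + v * (y \<bullet> a)"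
      using uv by (simp add: inner_add_left)
    also have "\<dots> = u * (r a + x \<bullet> a) + v * (r a + y \<bullet> a)"
      by (simp add: algebra_simps)
    also have "\<dots> \<le> u * B + v * C"
      using B C uv that by (intro add_mono mult_left_mono) auto
    finally show ?thesis .
  qed
  then show "u *\<^sub>R x + v *\<^sub>R y \<in> dual_domain \<rho> r"
    by (auto simp: dual_domain_iff)
qed

lemma orthant_subset_recession_cone:
  "{v. 0 \<le> v} \<subseteq> recession_cone (dual_domain \<rho> r)"
proof -
  have "x + t *\<^sub>R v \<in> dual_domain \<rho> r"
    if v: "0 \<le> v" and x: "x \<in> dual_domain \<rho> r" and t: "0 \<le> t" for v x and t :: real
  proof -
    obtain B where B: "\<forall>a\<le>\<rho>. r a + x \<bullet> a \<le> B"
      using x by (auto simp: dual_domain_iff)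
    have "r a + (x + t *\<^sub>R v) \<bullet> a \<le> B + t * (v \<bullet> \<rho>)" if a: "a \<le> \<rho>" for a
    proof -
      have "v \<bullet> a \<le> v \<bullet> \<rho>"
        using a v by (auto simp: inner_vec_def less_eq_vec_def intro!: sum_mono mult_left_mono)
      then have "t * (v \<bullet> a) \<le> t * (v \<bullet> \<rho>)"
        using t by (rule mult_left_mono)
      then show ?thesis
        using B a by (force simp: inner_add_left)
    qed
    then show ?thesis
      by (auto simp: dual_domain_iff)
  qed
  then show ?thesis
    by (auto simp: recession_cone_def)
qed

lemma lipschitz_constant_nonneg:
  fixes \<rho> :: "real ^ 'm"
  assumes lip: "\<forall>a\<le>\<rho>. \<forall>b\<le>\<rho>. \<bar>r a - r b\<bar> \<le> L * infnorm (a - b)"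
  shows "0 \<le> L"
proof -
  let ?e = "\<chi> j. 1 :: real ^ 'm"
  have "\<rho> - ?e \<le> \<rho>"
    by (simp add: less_eq_vec_def)
  then have "0 \<le> L * infnorm ?e"
    using lip[rule_format, of \<rho> "\<rho> - ?e"] by simp
  \<comment> \<open>The index type is nonempty, so \<open>?e\<close> is nonzero and the sign of
    \<open>L\<close> can be read off.\<close>
  moreover have "0 < infnorm ?e"
    by (simp add: infnorm_pos_lt vec_eq_iff)
  ultimately show ?thesis
    by (simp add: zero_le_mult_iff)
qed

text \<open>Common source of (ii) and (iii): the sum separates the coordinates, and each one
  contributes with the sign of \<open>\<mu> $ j - L\<close>, since \<open>b - a\<close> is
  nonnegative.\<close>

lemma objective_increase:
  fixes \<rho> :: "real ^ 'm"
  assumes lip: "\<forall>a\<le>\<rho>. \<forall>b\<le>\<rho>. \<bar>r a - r b\<bar> \<le> L * infnorm (a - b)"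
    and "a \<le> b" "b \<le> \<rho>"
  shows "r a + \<mu> \<bullet> a + (\<Sum>j\<in>UNIV. (\<mu> $ j - L) * (b $ j - a $ j)) \<le> r b + \<mu> \<bullet> b"
proof -
  have "a \<le> \<rho>"
    using assms(2,3) by (rule order_trans)
  then have "r a - r b \<le> L * infnorm (a - b)"
    using lip assms(3) by (meson abs_le_D1)
  also have "\<dots> = L * infnorm (b - a)"
    by (simp add: infnorm_sub)
  also have "\<dots> \<le> L * (\<Sum>j\<in>UNIV. (b - a) $ j)"
    using lipschitz_constant_nonneg[OF lip] assms(2)
    by (intro mult_left_mono infnorm_le_sum_cart) (auto simp: less_eq_vec_def)
  finally show ?thesis
    by (simp add: inner_vec_def algebra_simps sum.distrib sum_subtractf sum_distrib_left)
qed

text \<open>For this \<mu> every coefficient \<open>\<mu> $ j - L\<close> vanishes, so the value at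
  \<rho> bounds the objective.\<close>

lemma dual_domain_lipschitz_constant:
  fixes \<rho> :: "real ^ 'm"
  assumes lip: "\<forall>a\<le>\<rho>. \<forall>b\<le>\<rho>. \<bar>r a - r b\<bar> \<le> L * infnorm (a - b)"
  shows "L *\<^sub>R (\<chi> j. 1) \<in> dual_domain \<rho> r"
  using objective_increase[OF lip, where b = \<rho> and \<mu> = "L *\<^sub>R (\<chi> j. 1)"]
  by (auto simp: dual_domain_iff)

lemma maximizers_iff:
  "a \<in> maximizers \<rho> r \<mu> \<longleftrightarrow> a \<le> \<rho> \<and> (\<forall>b\<le>\<rho>. r b + \<mu> \<bullet> b \<le> r a + \<mu> \<bullet> a)"
  by (auto simp: maximizers_def is_arg_max_def not_less)

lemma maximizer_eq_bound:
  fixes \<rho> :: "real ^ 'm"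
  assumes lip: "\<forall>a\<le>\<rho>. \<forall>b\<le>\<rho>. \<bar>r a - r b\<bar> \<le> L * infnorm (a - b)"
    and a: "a \<in> maximizers \<rho> r \<mu>" and j: "L < \<mu> $ j"
  shows "a $ j = \<rho> $ j"
proof -
  \<comment> \<open>Only coordinate \<open>j\<close> is raised, so the sum in
    \<open>objective_increase\<close> collapses to a single term, whose factor
    \<open>\<mu> $ j - L\<close> is strictly positive.\<close>
  define b where "b = (\<chi> i. if i = j then \<rho> $ j else a $ i)"
  have ab: "a \<le> b" "b \<le> \<rho>"
    using a by (auto simp: maximizers_iff b_def less_eq_vec_def)
  have "r a + \<mu> \<bullet> a + (\<mu> $ j - L) * (\<rho> $ j - a $ j) \<le> r b + \<mu> \<bullet> b"
  proof -
    have "(\<Sum>i\<in>UNIV. (\<mu> $ i - L) * (b $ i - a $ i)) =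
        (\<Sum>i\<in>UNIV. if i = j then (\<mu> $ j - L) * (\<rho> $ j - a $ j) else 0)"
      by (rule sum.cong) (auto simp: b_def)
    then show ?thesis
      using objective_increase[OF lip ab, of \<mu>] by simp
  qed
  also have "\<dots> \<le> r a + \<mu> \<bullet> a"
    using a ab by (simp add: maximizers_iff)
  finally have "\<rho> $ j \<le> a $ j"
    using j by (simp add: mult_le_0_iff)
  then show ?thesis
    using a by (auto simp: maximizers_iff less_eq_vec_def intro: antisym)
qed

text \<open>Covers the boundary case \<open>\<mu> $ j = L\<close>, where a given maximizer may stay
  below \<rho>: raising all such coordinates at once adds only nonnegative terms, so optimality is
  kept.\<close>

lemma raised_maximizer:
  fixes \<rho> :: "real ^ 'm"
  assumes lip: "\<forall>a\<le>\<rho>. \<forall>b\<le>\<rho>. \<bar>r a - r b\<bar> \<le> L * infnorm (a - b)"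
    and a: "a \<in> maximizers \<rho> r \<mu>"
  shows "(\<chi> j. if L \<le> \<mu> $ j then \<rho> $ j else a $ j) \<in> maximizers \<rho> r \<mu>" (is "?b \<in> _")
proof -
  have ab: "a \<le> ?b" "?b \<le> \<rho>"
    using a by (auto simp: maximizers_iff less_eq_vec_def)
  have "0 \<le> (\<Sum>j\<in>UNIV. (\<mu> $ j - L) * (?b $ j - a $ j))"
    using a by (intro sum_nonneg) (auto simp: maximizers_iff less_eq_vec_def)
  then have "r a + \<mu> \<bullet> a \<le> r ?b + \<mu> \<bullet> ?b"
    using objective_increase[OF lip ab, of \<mu>] by linarith
  then show ?thesis
    using a ab by (auto simp: maximizers_iff intro: order_trans)
qed

lemma sum_negative_part_le:
  fixes \<rho> :: "real ^ 'm"
  assumes lip: "\<forall>a\<le>\<rho>. \<forall>b\<le>\<rho>. \<bar>r a - r b\<bar> \<le> L * infnorm (a - b)"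
    and "\<mu> \<in> dual_domain \<rho> r"
  shows "(\<Sum>j\<in>UNIV. max (- (\<mu> $ j)) 0) \<le> L" (is "?S \<le> L")
proof (rule ccontr)
  assume "\<not> ?S \<le> L"
  then have pos: "0 < ?S - L"
    by simp
  obtain B where B: "\<forall>a\<le>\<rho>. r a + \<mu> \<bullet> a \<le> B"
    using assms(2) by (auto simp: dual_domain_iff)
  define v :: "real ^ 'm" where "v = (\<chi> j. if \<mu> $ j < 0 then 1 else 0)"
  have v: "infnorm v \<le> 1"
    by (rule infnorm_le_cart) (simp add: v_def)
  have "\<mu> \<bullet> v = - ?S"
    unfolding inner_vec_def sum_negf[symmetric] by (rule sum.cong) (auto simp: v_def)
  \<comment> \<open>Going from \<rho> to \<open>\<rho> - t *\<^sub>R v\<close>, \<open>r\<close>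
    drops by at most \<open>L * t\<close> while the linear term gains \<open>t * ?S\<close>; the
    point stays below \<rho>, so \<open>B\<close> still applies.\<close>
  have bound: "t * (?S - L) \<le> B - (r \<rho> + \<mu> \<bullet> \<rho>)" if "0 \<le> t" for t
  proof -
    have le: "\<rho> - t *\<^sub>R v \<le> \<rho>"
      using that by (simp add: v_def less_eq_vec_def)
    then have "r \<rho> - r (\<rho> - t *\<^sub>R v) \<le> L * infnorm (t *\<^sub>R v)"
      using lip[rule_format, of \<rho> "\<rho> - t *\<^sub>R v"] by simp
    also have "\<dots> \<le> L * t"
      using that v lipschitz_constant_nonneg[OF lip]
      by (intro mult_left_mono) (auto simp: infnorm_mul mult_left_le)
    finally show ?thesis
      using B[rule_format, OF le] \<open>\<mu> \<bullet> v = - ?S\<close>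
      by (simp add: inner_diff_right algebra_simps)
  qed
  obtain n :: nat where "B - (r \<rho> + \<mu> \<bullet> \<rho>) < real n * (?S - L)"
    using reals_Archimedean3[OF pos] by blast
  then show False
    using bound[of "real n"] by simp
qed

theorem lemma1:
  fixes \<rho> :: "real ^ 'm" and r :: "real ^ 'm \<Rightarrow> real" and L :: real
  assumes "\<forall>j. 0 < \<rho> $ j"
    and "regularizer_assumptions \<rho> r L"
  shows "(convex (dual_domain \<rho> r) \<and> {v. 0 \<le> v} \<subseteq> recession_cone (dual_domain \<rho> r)) \<and>
    L *\<^sub>R (\<chi> j. 1) \<in> dual_domain \<rho> r \<and>
    (\<forall>\<mu>. \<forall>a\<in>maximizers \<rho> r \<mu>.
       (\<forall>j. L < \<mu> $ j \<longrightarrow> a $ j = \<rho> $ j) \<and>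
       (\<chi> j. if L \<le> \<mu> $ j then \<rho> $ j else a $ j) \<in> maximizers \<rho> r \<mu>) \<and>
    (\<forall>\<mu>\<in>dual_domain \<rho> r. (\<Sum>j\<in>UNIV. max (- (\<mu> $ j)) 0) \<le> L)"
proof -
  have lip: "\<forall>a\<le>\<rho>. \<forall>b\<le>\<rho>. \<bar>r a - r b\<bar> \<le> L * infnorm (a - b)"
    using assms(2) by (simp add: regularizer_assumptions_def)
  show ?thesis
    using convex_dual_domain orthant_subset_recession_cone dual_domain_lipschitz_constant[OF lip]
      maximizer_eq_bound[OF lip] raised_maximizer[OF lip] sum_negative_part_le[OF lip]
    by blast
qed

end
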